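(* Let $n\ge1$. The characteristic functions $$[[\mathbf{S}_1]]\bullet\cdots\bullet[[\mathbf{S}_l]],$$ i.e. the characteristic functions of the Minkowski sums $[\mathbf{S}_1]+\cdots+[\mathbf{S}_l]$, as $\{\mathbf{S}_1,\ldots,\mathbf{S}_l\}$ ranges over all standard composite set partitions of $\{1,\ldots,n\}$, form a basis of $\hat{\mathcal{P}}^n$.
   Context: $V_0^n=\{x\in\mathbb{R}^n:\sum x_i=0\}$, $x_S=\sum_{i\in S}x_i$. An ordered set partition of a set $J$ is a sequence of nonempty pairwise disjoint subsets with union $J$. For an ordered set partition $(T_1,\ldots,T_k)$ of $J\subseteq\{1,\ldots,n\}$, the plate $[T_1,\ldots,T_k]$ is $\{x\in\mathbb{R}^n: x_j=0\text{ for } j\notin J,\ x_{T_1\cup\cdots\cup T_i}\ge0\ (i=1,\ldots,k-1),\ x_J=0\}$, with characteristic function $[[T_1,\ldots,T_k]]$. $\hat{\mathcal{P}}^n$ is the complex vector space spanned by the characteristic functions of plates labelled by ordered set partitions of $\{1,\ldots,n\}$. $[C_1]\bullet[C_2]$ denotes the characteristic function of the Minkowski sum $C_1+C_2$. A composite set partition of $\{1,\ldots,n\}$ is a set $\{\mathbf{S}_1,\ldots,\mathbf{S}_l\}$ with each $\mathbf{S}_i$ an ordered set partition of $J_i$, where $\{J_1,\ldots,J_l\}$ is a set partition of $\{1,\ldots,n\}$; it is standard if the first block of each $\mathbf{S}_i$ contains $\min J_i$. *)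

theory Defs
  imports
    "HOL-Analysis.Analysis"
    "HOL-Library.Disjoint_Sets"
    "HOL-Library.Set_Algebras"
    "HOL-Library.Function_Algebras"
begin

text \<open>
  The index set \<open>{1, \<dots>, n}\<close> is rendered as a type \<open>'n\<close> of class
  \<^class>\<open>finite\<close> and \<^class>\<open>linorder\<close>, with \<open>n = CARD('n) \<ge> 1\<close>.
\<close>

text \<open>The complex vector space of all complex-valued functions on a type.\<close>

definition cfun_scale :: "complex \<Rightarrow> ('a \<Rightarrow> complex) \<Rightarrow> 'a \<Rightarrow> complex" where
  "cfun_scale c f = (\<lambda>x. c * f x)"

interpretation cfun: vector_space cfun_scale
  by standard (auto simp: cfun_scale_def fun_eq_iff algebra_simps)

definition ordered_set_partition_on :: "'a set \<Rightarrow> 'a set list \<Rightarrow> bool" where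
  "ordered_set_partition_on J Ts \<longleftrightarrow> distinct Ts \<and> partition_on J (set Ts)"

definition support :: "'a set list \<Rightarrow> 'a set" where
  "support Ts = \<Union>(set Ts)"

definition coord_sum :: "real ^ 'n \<Rightarrow> 'n set \<Rightarrow> real" where
  "coord_sum x S = (\<Sum>i\<in>S. x $ i)"

definition plate :: "'n set list \<Rightarrow> (real ^ 'n) set" where
  "plate Ts = {x. (\<forall>j. j \<notin> support Ts \<longrightarrow> x $ j = 0)
                \<and> (\<forall>i\<in>{1..<length Ts}. coord_sum x (support (take i Ts)) \<ge> 0)
                \<and> coord_sum x (support Ts) = 0}"

definition plate_space :: "(real ^ ('n::finite) \<Rightarrow> complex) set" where
  "plate_space = cfun.span {indicator (plate Ts) | Ts. ordered_set_partition_on UNIV Ts}"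

text \<open>
  Injectivity of \<^const>\<open>support\<close> says that distinct members of \<open>C\<close> have distinct
  (hence disjoint) supports; without it the set of supports could be a set
  partition although two members share one.
\<close>

definition composite_set_partition :: "'n set list set \<Rightarrow> bool" where
  "composite_set_partition C \<longleftrightarrow>
     (\<forall>S\<in>C. ordered_set_partition_on (support S) S) \<and>
     inj_on support C \<and> partition_on UNIV (support ` C)"

definition standard_composite_set_partition :: "'n::linorder set list set \<Rightarrow> bool" where
  "standard_composite_set_partition C \<longleftrightarrow>
     composite_set_partition C \<and> (\<forall>S\<in>C. Min (support S) \<in> hd S)"

text \<open>
  The big sum is the Minkowski sum of sets, by the instance of
  \<^class>\<open>comm_monoid_add\<close> for sets in \<^theory>\<open>HOL-Library.Set_Algebras\<close>.
\<close>

definition composite_plate :: "'n set list set \<Rightarrow> (real ^ 'n) set" where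
  "composite_plate C = (\<Sum>S\<in>C. plate S)"

definition composite_plate_fun :: "'n set list set \<Rightarrow> real ^ 'n \<Rightarrow> complex" where
  "composite_plate_fun C = indicator (composite_plate C)"

end

theory Submission
  imports Defs
begin

text \<open>
  A composite plate is the dual cone of \<open>{z. z\<^sub>a \<le> z\<^sub>b for (a, b) \<in> E}\<close>, where \<open>E\<close> relates
  each index to those in the same or an earlier block of the same part. Polar duality of closed
  convex cones preserves linear relations between indicator functions: \<open>x\<close> lies in the dual of
  \<open>K\<close> iff the slice of \<open>K\<close> by \<open>x \<bullet> z = -1\<close> is empty, and counting nonempty compact convex sets
  is additive (the Euler characteristic). So the theorem may be checked on the order cones. There
  a point \<open>z\<close> determines a weak order on the indices; cutting its chain of blocks where the running
  minimum of the indices drops yields a standard composite set partition, and every such partition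
  arises from a unique weak order. With respect to this bijection the incidence matrix between order
  cones and weak orders is unitriangular, hence invertible.
\<close>

section \<open>Euler characteristic and dual cones\<close>

text \<open>Moving from \<open>t\<close> to a point slightly to its right loses exactly the
  intervals that end at \<open>t\<close>, so their coefficients sum to 0. Summing over all right
  endpoints gives the claim.\<close>

lemma interval_family_sum_zero:
  fixes a b :: "'j \<Rightarrow> real" and c :: "'j \<Rightarrow> 'c::comm_monoid_add"
  assumes J: "finite J" and ab: "\<And>j. j \<in> J \<Longrightarrow> a j \<le> b j"
    and zero: "\<And>t. sum c {j \<in> J. t \<in> {a j..b j}} = 0"
  shows "sum c J = 0"
proof -
  have "sum c {j \<in> J. b j = t} = 0" for t
  proof -
    \<comment> \<open>\<open>B\<close> holds the endpoints beyond \<open>t\<close>. With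
      \<open>s\<close> strictly between \<open>t\<close> and all of \<open>B\<close>, no interval
      begins or ends after \<open>t\<close> and up to \<open>s\<close>.\<close>
    define B where "B = {s \<in> a ` J \<union> b ` J. t < s}"
    have "\<exists>s>t. \<forall>u\<in>B. s < u"
    proof (cases "B = {}")
      case True
      then show ?thesis using lt_ex gt_ex by blast
    next
      case False
      have "finite B" using J by (simp add: B_def)
      then have "t < Min B" using False by (auto simp: B_def)
      then obtain s where "t < s" "s < Min B" using dense by blast
      then show ?thesis using \<open>finite B\<close> False by auto
    qed
    then obtain s where s: "s > t" "\<And>u. u \<in> B \<Longrightarrow> s < u" by blast
    have s': "t < a j \<Longrightarrow> s < a j" "t < b j \<Longrightarrow> s < b j" if "j \<in> J" for j
      using that s(2) by (auto simp: B_def)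
    have "{j \<in> J. t \<in> {a j..b j}} = {j \<in> J. s \<in> {a j..b j}} \<union> {j \<in> J. b j = t}"
      using s(1) s' ab by (force simp: not_le not_less)
    moreover have "{j \<in> J. s \<in> {a j..b j}} \<inter> {j \<in> J. b j = t} = {}"
      using s(1) by auto
    ultimately have "sum c {j \<in> J. t \<in> {a j..b j}}
        = sum c {j \<in> J. s \<in> {a j..b j}} + sum c {j \<in> J. b j = t}"
      using J by (simp add: sum.union_disjoint)
    then show ?thesis using zero by simp
  qed
  then show ?thesis using sum.image_gen[OF J, of c b] by simp
qed

lemma indicator_sum_eq:
  "finite J \<Longrightarrow> (\<Sum>j\<in>J. c j * indicator (P j) x) = sum c {j \<in> J. x \<in> P j}"
  for c :: "'j \<Rightarrow> complex"
  unfolding sum.inter_filter by (rule sum.cong) (auto simp: indicator_def)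

text \<open>Induction on the set \<open>B\<close> of directions in which the sets may vary; in all
  others they agree with \<open>w\<close>. Slicing orthogonally to some \<open>b\<close> removes it
  from \<open>B\<close>. Projection to \<open>b\<close> turns nonempty sets into intervals, whose
  points are exactly the \<open>t\<close> with nonempty slice, so the one-dimensional case
  concludes.\<close>

lemma compact_convex_euler_sliced:
  fixes P :: "'j \<Rightarrow> 'a::euclidean_space set" and c :: "'j \<Rightarrow> complex"
  assumes B: "finite B" "B \<subseteq> Basis" and J: "finite J"
    and P: "\<And>j. j \<in> J \<Longrightarrow> compact (P j)" "\<And>j. j \<in> J \<Longrightarrow> convex (P j)"
    and flat: "\<And>j x b. j \<in> J \<Longrightarrow> x \<in> P j \<Longrightarrow> b \<in> Basis - B \<Longrightarrow> x \<bullet> b = w \<bullet> b"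
    and zero: "\<And>x. (\<Sum>j\<in>J. c j * indicator (P j) x) = 0"
  shows "sum c {j \<in> J. P j \<noteq> {}} = 0"
  using B P flat zero
proof (induction B arbitrary: P w rule: finite_induct)
  case empty
  \<comment> \<open>With no free direction, each \<open>P j\<close> is empty or the single point
    \<open>w\<close>.\<close>
  have "x = w" if "j \<in> J" "x \<in> P j" for j x
    using empty.prems(4)[OF that] by (auto intro: euclidean_eqI)
  then have "{j \<in> J. P j \<noteq> {}} = {j \<in> J. w \<in> P j}" by auto
  then show ?case using empty.prems(5)[of w] J by (simp add: indicator_sum_eq)
next
  case (insert b B)
  define H where "H t = {x::'a. x \<bullet> b = t}" for t
  have b: "b \<in> Basis" "b \<notin> B" using insert by auto
  have clH: "closed (H t)" and cvH: "convex (H t)" for t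
    using closed_hyperplane[of b t] convex_hyperplane[of b t] by (simp_all add: H_def inner_commute)
  have slice: "sum c {j \<in> J. P j \<inter> H t \<noteq> {}} = 0" for t
  proof (rule insert.IH)
    show "B \<subseteq> Basis" using insert by auto
    show "compact (P j \<inter> H t)" "convex (P j \<inter> H t)" if "j \<in> J" for j
      using insert.prems(2,3) that clH cvH by (auto intro: compact_Int_closed convex_Int)
    \<comment> \<open>The base point of the slice is \<open>w\<close> with its
      \<open>b\<close>-coordinate replaced by \<open>t\<close>.\<close>
    show "x \<bullet> b' = (w + (t - w \<bullet> b) *\<^sub>R b) \<bullet> b'"
      if "j \<in> J" "x \<in> P j \<inter> H t" "b' \<in> Basis - B" for j x b'
    proof (cases "b' = b")
      case True
      then show ?thesis using that b by (simp add: H_def inner_add_left)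
    next
      case False
      then show ?thesis using that b insert.prems(4)[of j x b']
        by (simp add: inner_add_left inner_Basis)
    qed
    show "(\<Sum>j\<in>J. c j * indicator (P j \<inter> H t) x) = 0" for x
      using insert.prems(5)[of x]
      by (cases "x \<in> H t") (simp_all add: indicator_inter_arith)
  qed
  \<comment> \<open>Empty sets project to empty intervals, which violate
    \<open>l j \<le> u j\<close>; they are left out.\<close>
  define J' where "J' = {j \<in> J. P j \<noteq> {}}"
  have "\<exists>l u. (\<lambda>x. x \<bullet> b) ` P j = {l..u}" if "j \<in> J" for j
  proof -
    have "compact ((\<lambda>x. x \<bullet> b) ` P j)"
      using insert.prems(2)[OF that] by (intro compact_continuous_image continuous_intros)
    moreover have "connected ((\<lambda>x. x \<bullet> b) ` P j)"
      using insert.prems(3)[OF that]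
      by (intro connected_continuous_image continuous_intros convex_connected)
    ultimately show ?thesis using connected_compact_interval_1 by blast
  qed
  then obtain l u where lu: "\<And>j. j \<in> J \<Longrightarrow> (\<lambda>x. x \<bullet> b) ` P j = {l j..u j}" by metis
  have "sum c J' = 0"
  proof (rule interval_family_sum_zero[where a = l and b = u])
    show "finite J'" using J by (simp add: J'_def)
    show "l j \<le> u j" if "j \<in> J'" for j
      using lu[of j] that by (force simp: J'_def)
    have "t \<in> {l j..u j} \<longleftrightarrow> P j \<inter> H t \<noteq> {}" if "j \<in> J" for j t
      unfolding lu[OF that, symmetric] by (auto simp: H_def)
    then have "{j \<in> J'. t \<in> {l j..u j}} = {j \<in> J. P j \<inter> H t \<noteq> {}}" for t
      by (auto simp: J'_def)
    then show "sum c {j \<in> J'. t \<in> {l j..u j}} = 0" for t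
      using slice by simp
  qed
  then show ?case by (simp add: J'_def)
qed

text \<open>With every direction free, the flatness hypothesis is vacuous. This is additivity of the
  Euler characteristic, whose value is 1 on a nonempty compact convex set.\<close>

lemma compact_convex_euler:
  fixes P :: "'j \<Rightarrow> 'a::euclidean_space set" and c :: "'j \<Rightarrow> complex"
  assumes "finite J" "\<And>j. j \<in> J \<Longrightarrow> compact (P j)" "\<And>j. j \<in> J \<Longrightarrow> convex (P j)"
    and "\<And>x. (\<Sum>j\<in>J. c j * indicator (P j) x) = 0"
  shows "sum c {j \<in> J. P j \<noteq> {}} = 0"
  using compact_convex_euler_sliced[of Basis J P 0 c] assms by auto

section \<open>Polar duality of closed convex cones\<close>

definition dual_cone :: "'a::real_inner set \<Rightarrow> 'a set" where
  "dual_cone K = {x. \<forall>z\<in>K. 0 \<le> x \<bullet> z}"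

lemma closed_dual_cone: "closed (dual_cone K)"
proof -
  have "dual_cone K = (\<Inter>z\<in>K. {x. 0 \<le> x \<bullet> z})" by (auto simp: dual_cone_def)
  then show ?thesis by (auto intro!: closed_INT closed_Collect_le continuous_intros)
qed

lemma convex_cone_dual_cone: "convex_cone (dual_cone K)"
  unfolding convex_cone_iff by (auto simp: dual_cone_def inner_add_left)

text \<open>The point \<open>x\<close> is outside the dual of \<open>K j\<close> iff
  \<open>K j\<close> meets the hyperplane where the pairing with \<open>x\<close> is -1. By the
  Euler characteristic the coefficients of these \<open>j\<close> sum to 0, and so do all
  coefficients; the difference is the claim.\<close>

lemma dual_cone_relation:
  fixes K :: "'j \<Rightarrow> 'a::euclidean_space set" and c :: "'j \<Rightarrow> complex"
  assumes J: "finite J" and K: "\<And>j. j \<in> J \<Longrightarrow> closed (K j)" "\<And>j. j \<in> J \<Longrightarrow> convex_cone (K j)"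
    and zero: "\<And>z. (\<Sum>j\<in>J. c j * indicator (K j) z) = 0"
  shows "(\<Sum>j\<in>J. c j * indicator (dual_cone (K j)) x) = 0"
proof -
  define N where "N = {j \<in> J. x \<notin> dual_cone (K j)}"
  have "\<exists>z\<in>K j. x \<bullet> z = - 1" if j: "j \<in> N" for j
  proof -
    obtain z where z: "z \<in> K j" "x \<bullet> z < 0" using j by (force simp: N_def dual_cone_def)
    then have "(1 / - (x \<bullet> z)) *\<^sub>R z \<in> K j"
      using K(2) j by (intro convex_cone_scaleR) (auto simp: N_def)
    then show ?thesis using z by (intro bexI) auto
  qed
  then obtain z where z: "\<And>j. j \<in> N \<Longrightarrow> z j \<in> K j" "\<And>j. j \<in> N \<Longrightarrow> x \<bullet> z j = - 1" by metis
  have "finite N" using J by (simp add: N_def)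
  then obtain R where R: "\<And>j. j \<in> N \<Longrightarrow> norm (z j) \<le> R"
    using finite_imp_bounded[of "z ` N"] by (auto simp: bounded_iff)
  \<comment> \<open>Slices of cones may be unbounded. The ball is large enough to keep the chosen
    point \<open>z j\<close> of each nonempty slice, so it makes the slices compact without emptying
    any.\<close>
  define Q where "Q j = K j \<inter> ({z. x \<bullet> z = - 1} \<inter> cball 0 R)" for j
  have "sum c {j \<in> J. Q j \<noteq> {}} = 0"
  proof (rule compact_convex_euler[OF J])
    show "compact (Q j)" if "j \<in> J" for j
      unfolding Q_def using K(1)[OF that]
      by (intro closed_Int_compact compact_cball closed_hyperplane)
    show "convex (Q j)" if "j \<in> J" for j
      unfolding Q_def using K(2)[OF that]
      by (intro convex_Int convex_hyperplane convex_cball) (simp add: convex_cone_def)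
    show "(\<Sum>j\<in>J. c j * indicator (Q j) z) = 0" for z
    proof (cases "z \<in> {z. x \<bullet> z = - 1} \<inter> cball 0 R")
      case True
      then have "indicator (Q j) z = (indicator (K j) z :: complex)" for j
        by (simp add: Q_def indicator_def)
      then show ?thesis using zero by simp
    next
      case False
      then have "indicator (Q j) z = (0 :: complex)" for j
        by (auto simp: Q_def indicator_def)
      then show ?thesis by simp
    qed
  qed
  moreover have "{j \<in> J. Q j \<noteq> {}} = N"
  proof
    have "z j \<in> Q j" if "j \<in> N" for j
      using z[OF that] R[OF that] by (simp add: Q_def)
    then show "N \<subseteq> {j \<in> J. Q j \<noteq> {}}" by (auto simp: N_def)
    have "x \<notin> dual_cone (K j)" if "w \<in> Q j" for j w
      using that by (force simp: Q_def dual_cone_def)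
    then show "{j \<in> J. Q j \<noteq> {}} \<subseteq> N" by (auto simp: N_def)
  qed
  ultimately have "sum c N = 0" by simp
  \<comment> \<open>The relation is evaluated at the origin, which lies in every cone.\<close>
  moreover have "sum c J = 0"
    using zero[of 0] K(2) by (simp add: convex_cone_contains_0)
  moreover have "(\<Sum>j\<in>J. c j * indicator (dual_cone (K j)) x) = sum c (J - N)"
    unfolding indicator_sum_eq[OF J] by (rule arg_cong[where f = "sum c"]) (auto simp: N_def)
  ultimately show ?thesis using J by (simp add: sum_diff N_def)
qed

section \<open>Cones of relations\<close>

definition order_cone :: "'n rel \<Rightarrow> (real ^ 'n::finite) set" where
  "order_cone E = {z. \<forall>(a, b)\<in>E. z $ a \<le> z $ b}"

lemma mem_order_cone: "z \<in> order_cone E \<longleftrightarrow> (\<forall>a b. (a, b) \<in> E \<longrightarrow> z $ a \<le> z $ b)"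
  by (auto simp: order_cone_def)

lemma closed_order_cone: "closed (order_cone E)"
proof -
  have "order_cone E = (\<Inter>p\<in>E. {z. z $ fst p \<le> z $ snd p})"
    by (force simp: order_cone_def)
  then show ?thesis by (simp add: closed_INT closed_Collect_le continuous_on_component)
qed

lemma convex_cone_order_cone: "convex_cone (order_cone E)"
proof -
  have "0 \<in> order_cone E" by (simp add: mem_order_cone)
  then show ?thesis
    unfolding convex_cone_iff by (auto simp: mem_order_cone intro!: add_mono mult_left_mono)
qed

text \<open>Each defining inequality of the order cone is a pairing with some
  \<open>axis b 1 - axis a 1\<close>, which lies in the dual cone; hence points of the double dual
  satisfy all of them.\<close>

lemma dual_dual_order_cone: "dual_cone (dual_cone (order_cone E)) = order_cone E"
proof
  show "dual_cone (dual_cone (order_cone E)) \<subseteq> order_cone E"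
  proof
    fix z assume z: "z \<in> dual_cone (dual_cone (order_cone E))"
    have "z $ a \<le> z $ b" if ab: "(a, b) \<in> E" for a b
    proof -
      have "axis b 1 - axis a 1 \<in> dual_cone (order_cone E)"
        using ab by (auto simp: dual_cone_def mem_order_cone inner_diff_left inner_axis')
      then have "0 \<le> z \<bullet> (axis b 1 - axis a 1)" using z by (auto simp: dual_cone_def)
      then show ?thesis by (simp add: inner_diff_right inner_axis)
    qed
    then show "z \<in> order_cone E" by (simp add: mem_order_cone)
  qed
  show "order_cone E \<subseteq> dual_cone (dual_cone (order_cone E))"
    by (auto simp: dual_cone_def inner_commute)
qed

text \<open>Duality is applied once in each direction, the second time using the double dual. This
  transfers linear relations between the plate side and the order cones.\<close>

lemma order_cone_relation_iff:
  fixes c :: "'n::finite rel \<Rightarrow> complex"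
  shows "(\<forall>x. (\<Sum>E\<in>F. c E * indicator (dual_cone (order_cone E)) x) = 0) \<longleftrightarrow>
    (\<forall>z. (\<Sum>E\<in>F. c E * indicator (order_cone E) z) = 0)" (is "?L \<longleftrightarrow> ?R")
proof
  have F: "finite F" by (rule finite_subset[OF subset_UNIV]) simp
  show "?R \<Longrightarrow> ?L"
    using dual_cone_relation[OF F, of order_cone c] closed_order_cone convex_cone_order_cone
    by blast
  assume ?L
  then show ?R
    using dual_cone_relation[OF F, of "\<lambda>E. dual_cone (order_cone E)" c]
    by (simp add: dual_dual_order_cone closed_dual_cone convex_cone_dual_cone)
qed

section \<open>Triangular systems of indicator functions\<close>

text \<open>The fibres of \<open>K\<close> are cells labelled by \<open>F\<close>, and by
  \<open>mem_cong\<close> each \<open>D E\<close> is a union of cells. The incidence matrix of sets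
  and cells is unitriangular with respect to \<open>\<mu>\<close>.\<close>

locale triangular_family =
  fixes F :: "'i set" and D :: "'i \<Rightarrow> 'x set" and K :: "'x \<Rightarrow> 'i" and \<mu> :: "'i \<Rightarrow> nat"
  assumes finite: "finite F"
    and surj: "K ` UNIV = F"
    and self: "z \<in> D (K z)"
    and less: "E \<in> F \<Longrightarrow> z \<in> D E \<Longrightarrow> E \<noteq> K z \<Longrightarrow> \<mu> E < \<mu> (K z)"
    and mem_cong: "K z = K z' \<Longrightarrow> E \<in> F \<Longrightarrow> z \<in> D E \<longleftrightarrow> z' \<in> D E"
begin

text \<open>The relation is evaluated in the cell of \<open>E\<close>: any other set containing that
  cell has smaller \<open>\<mu>\<close>, so its coefficient is already known to vanish.\<close>

lemma independent:
  fixes c :: "'i \<Rightarrow> complex"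
  assumes zero: "\<And>z. (\<Sum>E\<in>F. c E * indicator (D E) z) = 0" and "E \<in> F"
  shows "c E = 0"
  using \<open>E \<in> F\<close>
proof (induction "\<mu> E" arbitrary: E rule: less_induct)
  case less
  obtain z where z: "E = K z" using less.prems surj by blast
  have "c E' * indicator (D E') z = 0" if "E' \<in> F - {E}" for E'
    using that less.hyps[of E'] triangular_family.less[OF triangular_family_axioms, of E' z] z
    by (cases "z \<in> D E'") auto
  then have "(\<Sum>E'\<in>F - {E}. c E' * indicator (D E') z) = 0"
    by (intro sum.neutral ballI)
  then have "(\<Sum>E\<in>F. c E * indicator (D E) z) = c E * indicator (D E) z"
    using sum.remove[OF finite less.prems, of "\<lambda>E. c E * indicator (D E) z"] by simp
  then show ?case using zero[of z] self z by simp
qed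

text \<open>Forward substitution: the expansion is made correct on the cells with
  \<open>\<mu>\<close> below \<open>n\<close>, for increasing \<open>n\<close>.\<close>

lemma spanning:
  fixes g :: "'x \<Rightarrow> complex"
  assumes g: "\<And>z z'. K z = K z' \<Longrightarrow> g z = g z'"
  shows "\<exists>c. \<forall>z. g z = (\<Sum>E\<in>F. c E * indicator (D E) z)"
proof -
  have "\<exists>c. \<forall>z. \<mu> (K z) < n \<longrightarrow> g z = (\<Sum>E\<in>F. c E * indicator (D E) z)" for n
  proof (induction n)
    case (Suc n)
    then obtain c where c: "\<And>z. \<mu> (K z) < n \<Longrightarrow> g z = (\<Sum>E\<in>F. c E * indicator (D E) z)"
      by blast
    define err where "err z = g z - (\<Sum>E\<in>F. c E * indicator (D E) z)" for z
    define rep where "rep E = (SOME z. K z = E)" for E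
    \<comment> \<open>The correction at level \<open>n\<close> is the remaining error on each cell
      of that level. A set of level \<open>n\<close> contains no other cell of level at most
      \<open>n\<close>, so nothing already correct is disturbed.\<close>
    define c' where "c' E = (if \<mu> E = n then err (rep E) else 0)" for E
    have rep: "K (rep (K z)) = K z" for z
      unfolding rep_def by (rule someI) simp
    have err_cong: "err z = err z'" if "K z = K z'" for z z'
    proof -
      have "indicator (D E) z = (indicator (D E) z' :: complex)" if "E \<in> F" for E
        using mem_cong[OF \<open>K z = K z'\<close> that] by (simp add: indicator_def)
      then show ?thesis using g[OF that] by (simp add: err_def)
    qed
    have "err z = (\<Sum>E\<in>F. c' E * indicator (D E) z)" if z: "\<mu> (K z) < Suc n" for z
    proof -
      have "c' E * indicator (D E) z = 0" if "E \<in> F - {K z}" for E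
        using that less[of E z] z by (cases "z \<in> D E") (auto simp: c'_def)
      then have "(\<Sum>E\<in>F - {K z}. c' E * indicator (D E) z) = 0"
        by (intro sum.neutral ballI)
      moreover have "K z \<in> F" using surj by blast
      ultimately have "(\<Sum>E\<in>F. c' E * indicator (D E) z) = c' (K z) * indicator (D (K z)) z"
        using sum.remove[OF finite, of "K z" "\<lambda>E. c' E * indicator (D E) z"] by simp
      also have "\<dots> = c' (K z)" using self by simp
      also have "\<dots> = err z"
        using z c[of z] err_cong[OF rep] by (auto simp: c'_def err_def)
      finally show ?thesis by simp
    qed
    then have "\<mu> (K z) < Suc n \<Longrightarrow> g z = (\<Sum>E\<in>F. (c E + c' E) * indicator (D E) z)" for z
      by (simp add: err_def algebra_simps sum.distrib)
    then show ?case by (intro exI[of _ "\<lambda>E. c E + c' E"]) blast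
  qed simp
  moreover have "\<mu> (K z) < Suc (Max (\<mu> ` F))" for z
    using finite surj by (auto intro!: Max_ge simp: less_Suc_eq_le)
  ultimately show ?thesis by meson
qed

end

section \<open>Weak orders and their pieces\<close>

definition weak_order :: "real ^ 'n \<Rightarrow> 'n rel" where
  "weak_order y = {(a, b). y $ a \<le> y $ b}"

text \<open>
  The running minimum of the indices, read along decreasing values of \<open>y\<close>; its level sets are the
  parts of the standard composite set partition attached to \<open>y\<close>.
\<close>

definition leader :: "real ^ 'n::{finite,linorder} \<Rightarrow> 'n \<Rightarrow> 'n" where
  "leader y a = Min {b. y $ a \<le> y $ b}"

text \<open>This is the \<open>composite_order\<close> of the attached composite set partition,
  expressed through \<open>y\<close> alone.\<close>

definition piece_order :: "real ^ 'n::{finite,linorder} \<Rightarrow> 'n rel" where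
  "piece_order y = {(a, b). leader y a = leader y b \<and> y $ a \<le> y $ b}"

lemma leader_ge: "y $ a \<le> y $ leader y a"
  using Min_in[of "{b. y $ a \<le> y $ b}"] by (auto simp: leader_def)

lemma leader_le: "y $ a \<le> y $ b \<Longrightarrow> leader y a \<le> b"
  by (auto simp: leader_def)

lemma leader_eqI: "y $ a \<le> y $ m \<Longrightarrow> (\<And>b. y $ a \<le> y $ b \<Longrightarrow> m \<le> b) \<Longrightarrow> leader y a = m"
  by (meson antisym leader_ge leader_le)

lemma leader_mono: "y $ a \<le> y $ b \<Longrightarrow> leader y a \<le> leader y b"
  by (meson leader_ge leader_le order_trans)

lemma leader_leader: "leader y (leader y a) = leader y a"
  by (meson leader_eqI leader_ge leader_le order_refl order_trans)

lemma leader_self_le: "leader y a \<le> a"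
  by (simp add: leader_le)

lemma piece_order_leader: "(a, leader y a) \<in> piece_order y"
  by (simp add: piece_order_def leader_leader leader_ge)

text \<open>The leaders can thus be recovered from the relation without knowing
  \<open>y\<close>.\<close>

lemma leader_piece_order: "leader y a = Min (piece_order y `` {a})"
proof (rule Min_eqI[symmetric])
  show "leader y a \<le> b" if "b \<in> piece_order y `` {a}" for b
    using that by (auto simp: piece_order_def leader_self_le)
qed (auto simp: piece_order_leader)

text \<open>Since \<open>leader y\<close> is monotone in the value of \<open>y\<close>, indices with
  different leaders are ordered as their leaders are.\<close>

lemma weak_order_piece_order:
  "(a, b) \<in> weak_order y \<longleftrightarrow> leader y a < leader y b \<or> (a, b) \<in> piece_order y"
  using leader_mono[of y a b] leader_mono[of y b a] linear[of "y $ a" "y $ b"]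
  by (auto simp: weak_order_def piece_order_def)

text \<open>Cutting the chain loses nothing: the pieces determine the leaders, and the leaders tell
  how to stack the pieces.\<close>

lemma piece_order_eq_iff: "piece_order y = piece_order z \<longleftrightarrow> weak_order y = weak_order z"
proof
  assume eq: "piece_order y = piece_order z"
  then have "leader y = leader z" by (simp add: fun_eq_iff leader_piece_order)
  then show "weak_order y = weak_order z"
    using eq weak_order_piece_order[of _ _ y] weak_order_piece_order[of _ _ z] by auto
next
  assume eq: "weak_order y = weak_order z"
  then have le: "y $ a \<le> y $ b \<longleftrightarrow> z $ a \<le> z $ b" for a b
    by (auto simp: weak_order_def set_eq_iff)
  then show "piece_order y = piece_order z" by (simp add: piece_order_def leader_def)
qed

lemma order_cone_iff_weak_order: "z \<in> order_cone E \<longleftrightarrow> E \<subseteq> weak_order z"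
  by (auto simp: order_cone_def weak_order_def)

lemma leader_antimono:
  assumes "z \<in> order_cone (piece_order y)"
  shows "leader z a \<le> leader y a"
  using assms piece_order_leader[of a y] by (auto simp: mem_order_cone intro: leader_le)

text \<open>A lexicographic order encoded in one number: first how small the leaders are, then the
  size of the relation. The factor exceeds the size of any relation.\<close>

definition piece_measure :: "'n::{finite,linorder} rel \<Rightarrow> nat" where
  "piece_measure E =
     (\<Sum>a\<in>UNIV. card {Min (E `` {a})<..}) * Suc (card (UNIV :: 'n rel)) + card E"

text \<open>Leaders can only drop from \<open>y\<close> to \<open>z\<close>. If none drops, the
  relation itself grows strictly; if one drops, the dominant term grows.\<close>

lemma piece_measure_less:
  fixes y z :: "real ^ 'n::{finite,linorder}"
  assumes z: "z \<in> order_cone (piece_order y)" and ne: "piece_order y \<noteq> piece_order z"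
  shows "piece_measure (piece_order y) < piece_measure (piece_order z)"
proof (cases "leader y = leader z")
  case True
  then have "piece_order y \<subset> piece_order z"
    using z ne by (auto simp: piece_order_def mem_order_cone)
  then have "card (piece_order y) < card (piece_order z)" by (simp add: psubset_card_mono)
  then show ?thesis using True by (simp add: piece_measure_def leader_piece_order[symmetric])
next
  case False
  let ?s = "\<lambda>y::real ^ 'n::{finite,linorder}. \<Sum>a\<in>UNIV. card {leader y a<..}" and ?N = "card (UNIV :: 'n rel)"
  have le: "leader z a \<le> leader y a" for a using leader_antimono[OF z] .
  obtain a where "leader y a \<noteq> leader z a" using False by auto
  then have a: "leader z a < leader y a" using le[of a] by simp
  have "?s y < ?s z"
  proof (rule sum_strict_mono_ex1)
    show "\<forall>a\<in>UNIV. card {leader y a<..} \<le> card {leader z a<..}"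
      using le by (auto intro!: card_mono elim: order.strict_trans1)
    show "\<exists>a\<in>UNIV. card {leader y a<..} < card {leader z a<..}"
      using a by (intro bexI[of _ a] psubset_card_mono) auto
  qed simp
  then have "Suc (?s y) * Suc ?N \<le> ?s z * Suc ?N" by (intro mult_le_mono1) simp
  moreover have "card (piece_order y) \<le> ?N" by (intro card_mono) auto
  ultimately show ?thesis by (simp add: piece_measure_def leader_piece_order[symmetric])
qed

text \<open>By \<open>piece_order_eq_iff\<close> the cells are the same as for weak orders; only the
  labelling cones differ.\<close>

interpretation piece: triangular_family "range piece_order"
  "order_cone :: 'n::{finite,linorder} rel \<Rightarrow> _" piece_order piece_measure
proof
  fix z z' :: "real ^ 'n::{finite,linorder}" and E :: "'n rel"
  show "z \<in> order_cone (piece_order z)"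
    by (simp add: mem_order_cone piece_order_def)
  show "z \<in> order_cone E \<longleftrightarrow> z' \<in> order_cone E" if "piece_order z = piece_order z'"
    using that by (simp add: piece_order_eq_iff order_cone_iff_weak_order)
  show "piece_measure E < piece_measure (piece_order z)"
    if "E \<in> range piece_order" "z \<in> order_cone E" "E \<noteq> piece_order z"
    using that piece_measure_less by blast
qed simp_all

interpretation weak: triangular_family "range weak_order" order_cone weak_order card
proof
  fix z :: "real ^ 'n" and E
  assume "z \<in> order_cone E" "E \<noteq> weak_order z"
  then show "card E < card (weak_order z)"
    by (intro psubset_card_mono) (auto simp: order_cone_iff_weak_order)
qed (auto simp: order_cone_iff_weak_order)

section \<open>Block orders of ordered set partitions\<close>

lemma support_simps [simp]: "support [] = {}" "support (T # Ts) = T \<union> support Ts"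
  by (auto simp: support_def)

lemma ordered_set_partition_on_Nil [simp]: "ordered_set_partition_on J [] \<longleftrightarrow> J = {}"
  by (auto simp: ordered_set_partition_on_def partition_on_def)

lemma ordered_set_partition_on_Cons:
  "ordered_set_partition_on J (T # Ts) \<longleftrightarrow>
    T \<noteq> {} \<and> T \<subseteq> J \<and> ordered_set_partition_on (J - T) Ts" (is "?L \<longleftrightarrow> ?R")
proof
  assume L: ?L
  then have "T \<inter> U = {}" if "U \<in> set Ts" for U
    using that by (auto simp: ordered_set_partition_on_def partition_on_def disjoint_def)
  then have "\<Union>(set Ts) = J - T"
    using L by (auto simp: ordered_set_partition_on_def partition_on_def)
  then show ?R
    using L by (auto simp: ordered_set_partition_on_def partition_on_def disjoint_def)
next
  assume R: ?R
  then have U: "\<Union>(set Ts) = J - T"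
    by (auto simp: ordered_set_partition_on_def partition_on_def)
  then have "T \<notin> set Ts" using R by auto
  then show ?L
    using R U by (auto simp: ordered_set_partition_on_def partition_on_def disjoint_def)
qed

lemma ordered_set_partition_on_support: "ordered_set_partition_on J S \<Longrightarrow> support S = J"
  by (auto simp: ordered_set_partition_on_def partition_on_def support_def)

text \<open>Earlier blocks are higher, so that the prefixes in the definition of a plate become
  up-sets.\<close>

fun block_order :: "'a set list \<Rightarrow> 'a rel" where
  "block_order [] = {}"
| "block_order (T # Ts) = support (T # Ts) \<times> T \<union> block_order Ts"

fun block_index :: "'a set list \<Rightarrow> 'a \<Rightarrow> nat" where
  "block_index [] a = 0"
| "block_index (T # Ts) a = (if a \<in> T then 0 else Suc (block_index Ts a))"

lemma block_order_index:
  "ordered_set_partition_on J S \<Longrightarrow>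
    block_order S = {(a, b) \<in> J \<times> J. block_index S b \<le> block_index S a}"
proof (induction S arbitrary: J)
  case (Cons T Ts)
  then have T: "T \<subseteq> J" "ordered_set_partition_on (J - T) Ts"
    by (auto simp: ordered_set_partition_on_Cons)
  then show ?case
    using Cons.IH[OF T(2)] ordered_set_partition_on_support[OF T(2)] by auto
qed simp

text \<open>The first block consists of the greatest elements, so it can be read off the
  relation.\<close>

lemma block_order_hd:
  assumes "ordered_set_partition_on J S" "J \<noteq> {}"
  shows "hd S = {b \<in> J. J \<times> {b} \<subseteq> block_order S}"
proof (cases S)
  case (Cons T Ts)
  then obtain t where T: "t \<in> T" "T \<subseteq> J"
    using assms by (auto simp: ordered_set_partition_on_Cons)
  then show ?thesis
    using Cons unfolding block_order_index[OF assms(1)]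
    by (auto split: if_splits dest: bspec[of _ _ t])
qed (use assms in auto)

text \<open>The first block is recovered as the set of greatest elements; restricting the relation
  to its complement handles the remaining blocks.\<close>

lemma block_order_inject:
  assumes "ordered_set_partition_on J S" "ordered_set_partition_on J S'"
    and "block_order S = block_order S'"
  shows "S = S'"
  using assms
proof (induction S arbitrary: J S')
  case Nil
  then show ?case by (cases S') (auto simp: ordered_set_partition_on_Cons)
next
  case (Cons T Ts)
  then have "J \<noteq> {}" by (auto simp: ordered_set_partition_on_Cons)
  then have "hd S' = T"
    using block_order_hd[OF Cons.prems(1)] block_order_hd[OF Cons.prems(2)] Cons.prems(3) by simp
  moreover have "S' \<noteq> []" using Cons.prems(2) \<open>J \<noteq> {}\<close> by auto
  ultimately obtain Ts' where S': "S' = T # Ts'" by (metis list.collapse)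
  have tl: "block_order Us = block_order (T # Us) \<inter> (J - T) \<times> (J - T)"
    if "ordered_set_partition_on J (T # Us)" for Us
  proof -
    have "ordered_set_partition_on (J - T) Us"
      using that by (simp add: ordered_set_partition_on_Cons)
    then show ?thesis using block_order_index[of "J - T" Us] by auto
  qed
  have "Ts = Ts'"
  proof (rule Cons.IH)
    show "block_order Ts = block_order Ts'"
      using tl[of Ts] tl[of Ts'] Cons.prems S' by metis
  qed (use Cons.prems S' in \<open>auto simp: ordered_set_partition_on_Cons\<close>)
  then show ?case by (simp add: S')
qed

text \<open>The first block is where \<open>y\<close> is maximal; the rest follows by
  recursion.\<close>

lemma ex_ordered_set_partition:
  fixes y :: "'a \<Rightarrow> 'b::linorder"
  assumes "finite J"
  shows "\<exists>S. ordered_set_partition_on J S \<and> block_order S = {(a, b) \<in> J \<times> J. y a \<le> y b}"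
  using assms
proof (induction J rule: finite_psubset_induct)
  case (psubset J)
  show ?case
  proof (cases "J = {}")
    case True
    then show ?thesis by (intro exI[of _ "[]"]) auto
  next
    case False
    define T where "T = {b \<in> J. y b = Max (y ` J)}"
    have max: "y a \<le> Max (y ` J)" if "a \<in> J" for a using psubset.hyps that by simp
    have "Max (y ` J) \<in> y ` J" using psubset.hyps False by (intro Max_in) auto
    then have T: "T \<noteq> {}" "T \<subseteq> J" by (auto simp: T_def)
    then have "J - T \<subset> J" by auto
    from psubset.IH[OF this] obtain S where S: "ordered_set_partition_on (J - T) S"
      "block_order S = {(a, b) \<in> (J - T) \<times> (J - T). y a \<le> y b}" by blast
    have "b \<in> T" if "a \<in> T" "b \<in> J" "y a \<le> y b" for a b
      using that max[of b] by (simp add: T_def)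
    moreover have "y a \<le> y b" if "a \<in> J" "b \<in> T" for a b
      using that max[of a] by (simp add: T_def)
    ultimately have "(a, b) \<in> block_order (T # S) \<longleftrightarrow> a \<in> J \<and> b \<in> J \<and> y a \<le> y b" for a b
      using T(2) unfolding block_order.simps S(2) support_simps
        ordered_set_partition_on_support[OF S(1)] by blast
    then have "block_order (T # S) = {(a, b) \<in> J \<times> J. y a \<le> y b}" by auto
    then show ?thesis
      using S(1) T by (intro exI[of _ "T # S"]) (auto simp: ordered_set_partition_on_Cons)
  qed
qed

text \<open>Prefixes are closed upwards, which puts their indicator vectors into the order
  cone.\<close>

lemma block_order_take:
  assumes "ordered_set_partition_on J S" "(a, b) \<in> block_order S" "a \<in> support (take i S)"
  shows "b \<in> support (take i S)"
  using assms
proof (induction S arbitrary: J i)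
  case (Cons T Ts)
  then have Ts: "ordered_set_partition_on (J - T) Ts"
    by (simp add: ordered_set_partition_on_Cons)
  show ?case
  proof (cases "b \<in> T")
    case False
    then have ab: "(a, b) \<in> block_order Ts" using Cons.prems(2) by auto
    then have "a \<notin> T" using block_order_index[OF Ts] by auto
    then show ?thesis using Cons.IH[OF Ts ab] Cons.prems(3) by (cases i) auto
  qed (use Cons.prems in \<open>cases i; auto\<close>)
qed simp

section \<open>Composite set partitions\<close>

definition composite_order :: "'a set list set \<Rightarrow> 'a rel" where
  "composite_order C = (\<Union>S\<in>C. block_order S)"

lemma composite_member:
  assumes "composite_set_partition C" "S \<in> C"
  shows "ordered_set_partition_on (support S) S" "support S \<noteq> {}"
  using assms by (auto simp: composite_set_partition_def partition_on_def)

lemma composite_cover: "composite_set_partition C \<Longrightarrow> \<exists>S\<in>C. a \<in> support S"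
  unfolding composite_set_partition_def partition_on_def by blast

lemma composite_unique:
  assumes "composite_set_partition C" "S \<in> C" "S' \<in> C" "a \<in> support S" "a \<in> support S'"
  shows "S = S'"
proof -
  have "support S = support S'"
    using assms unfolding composite_set_partition_def partition_on_def disjoint_def
    by (metis IntI empty_iff imageI)
  then show ?thesis
    using assms unfolding composite_set_partition_def by (metis inj_onD)
qed

lemma mem_composite_order_iff:
  assumes "composite_set_partition C" "S \<in> C" "a \<in> support S \<or> b \<in> support S"
  shows "(a, b) \<in> composite_order C \<longleftrightarrow> (a, b) \<in> block_order S"
proof
  assume "(a, b) \<in> composite_order C"
  then obtain S' where S': "S' \<in> C" "(a, b) \<in> block_order S'" by (auto simp: composite_order_def)
  then have "a \<in> support S'" "b \<in> support S'"
    using block_order_index[OF composite_member(1)[OF assms(1) S'(1)]] by auto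
  then have "S = S'" using composite_unique[OF assms(1,2) S'(1)] assms(3) by blast
  then show "(a, b) \<in> block_order S" using S' by simp
qed (use assms in \<open>auto simp: composite_order_def\<close>)

text \<open>The part of \<open>a\<close> is the set of indices comparable with \<open>a\<close>, and
  the relation restricted to a part determines its ordered set partition.\<close>

lemma composite_order_inject_subset:
  assumes C: "composite_set_partition C" and C': "composite_set_partition C'"
    and eq: "composite_order C = composite_order C'"
  shows "C \<subseteq> C'"
proof
  fix S assume S: "S \<in> C"
  then obtain a where a: "a \<in> support S" using composite_member(2)[OF C] by blast
  obtain S' where S': "S' \<in> C'" "a \<in> support S'" using composite_cover[OF C'] by blast
  have supp: "support U = {b. (a, b) \<in> composite_order D \<or> (b, a) \<in> composite_order D}"
    if "composite_set_partition D" "U \<in> D" "a \<in> support U" for D U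
  proof -
    have "(a, b) \<in> composite_order D \<or> (b, a) \<in> composite_order D \<longleftrightarrow>
        (a, b) \<in> block_order U \<or> (b, a) \<in> block_order U" for b
      using mem_composite_order_iff[OF that(1,2), of a b]
        mem_composite_order_iff[OF that(1,2), of b a] that(3) by simp
    moreover have "(a, b) \<in> block_order U \<or> (b, a) \<in> block_order U \<longleftrightarrow> b \<in> support U" for b
      using that(3) linear[of "block_index U a" "block_index U b"]
      by (auto simp: block_order_index[OF composite_member(1)[OF that(1,2)]])
    ultimately show ?thesis by blast
  qed
  have ord: "block_order U = composite_order D \<inter> support U \<times> support U"
    if "composite_set_partition D" "U \<in> D" for D U
  proof -
    have "block_order U \<subseteq> support U \<times> support U"
      using block_order_index[OF composite_member(1)[OF that]] by auto
    moreover have "(a, b) \<in> composite_order D \<longleftrightarrow> (a, b) \<in> block_order U"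
      if "a \<in> support U" for a b
      using mem_composite_order_iff[OF \<open>composite_set_partition D\<close> \<open>U \<in> D\<close>] that by blast
    ultimately have "(a, b) \<in> block_order U \<longleftrightarrow>
        (a, b) \<in> composite_order D \<inter> support U \<times> support U" for a b by blast
    then show ?thesis by auto
  qed
  have J: "support S = support S'"
    using supp[OF C S a] supp[OF C' S'] eq by simp
  have "block_order S = block_order S'"
    using ord[OF C S] ord[OF C' S'(1)] eq J by simp
  then have "S = S'"
    using block_order_inject composite_member(1)[OF C S] composite_member(1)[OF C' S'(1)] J by metis
  then show "S \<in> C'" using S' by simp
qed

lemma composite_order_inject:
  "composite_set_partition C \<Longrightarrow> composite_set_partition C' \<Longrightarrow>
    composite_order C = composite_order C' \<Longrightarrow> C = C'"
  by (simp add: composite_order_inject_subset subset_antisym)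

text \<open>The parts are stacked by increasing minimum, each with its blocks descending, and the
  running minimum of the resulting \<open>y\<close> recovers the parts.\<close>

lemma standard_composite_order_ex_piece_order:
  fixes C :: "'n::{finite,linorder} set list set"
  assumes std: "standard_composite_set_partition C"
  shows "\<exists>y. piece_order y = composite_order C"
proof -
  have C: "composite_set_partition C" and first: "\<And>S. S \<in> C \<Longrightarrow> Min (support S) \<in> hd S"
    using std by (auto simp: standard_composite_set_partition_def)
  obtain part where part: "\<And>a. part a \<in> C" "\<And>a. a \<in> support (part a)"
    using composite_cover[OF C] by metis
  have part_eq: "part a = part b \<longleftrightarrow> a \<in> support (part b)" for a b
    using part composite_unique[OF C] by metis
  define m where "m a = Min (support (part a))" for a
  define k where "k a = block_index (part a) a" for a
  define N where "N = Suc (\<Sum>a\<in>UNIV. k a)"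
  define r where "r a = card {..<m a}" for a
  \<comment> \<open>\<open>r\<close> ranks the parts by their minima and \<open>k\<close> is the
    block number. As \<open>N\<close> exceeds every \<open>k\<close>, different parts occupy
    disjoint ranges of values.\<close>
  define y where "y = (\<chi> a. real (N * r a) - real (k a))"
  have m_in: "m a \<in> support (part a)" for a
    using part(2)[of a] unfolding m_def by (intro Min_in) auto
  have m_le: "m a \<le> a" for a using part(2)[of a] by (auto simp: m_def)
  have part_m: "part (m a) = part a" for a using m_in by (simp add: part_eq)
  have m_eq: "m a = m b \<longleftrightarrow> part a = part b" for a b
    using part_m by (metis m_def)
  \<comment> \<open>Standardness enters here: the minimum of a part lies in its block number
    0.\<close>
  have k_m: "k (m a) = 0" for a
    using first[OF part(1), of a] composite_member[OF C part(1), of a]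
    unfolding k_def part_m by (cases "part a") (auto simp: m_def)
  have kN: "k a < N" for a
    using member_le_sum[of a UNIV k] by (simp add: N_def)
  have y_less: "y $ a < y $ b" if "m a < m b" for a b
  proof -
    have "r a < r b"
      unfolding r_def using that by (intro psubset_card_mono) auto
    then have "N * r a + N \<le> N * r b"
      using mult_le_mono2[of "Suc (r a)" "r b" N] by simp
    then have "N * r a + k b < N * r b + k a" using kN[of b] by simp
    then have "real (N * r a + k b) < real (N * r b + k a)" by (simp only: of_nat_less_iff)
    then show ?thesis by (simp add: y_def)
  qed
  have y_le: "y $ a \<le> y $ b \<longleftrightarrow> k b \<le> k a" if "part a = part b" for a b
    using that by (simp add: y_def r_def m_def)
  have m_mono: "m a \<le> m b" if "y $ a \<le> y $ b" for a b
    using y_less[of b a] that by (meson not_le)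
  \<comment> \<open>The minimum of a part is on top of it, and everything at or above
    \<open>a\<close> belongs to a part whose minimum is at least \<open>m a\<close>.\<close>
  have leader: "leader y a = m a" for a
  proof (rule leader_eqI)
    have "m (m a) = m a" by (simp add: m_eq part_m)
    then show "y $ a \<le> y $ m a" using k_m[of a] by (simp add: y_def r_def)
    show "m a \<le> b" if "y $ a \<le> y $ b" for b using m_mono[OF that] m_le by (rule order_trans)
  qed
  have "(a, b) \<in> piece_order y \<longleftrightarrow> (a, b) \<in> composite_order C" for a b
  proof -
    have "(a, b) \<in> piece_order y \<longleftrightarrow> part a = part b \<and> k b \<le> k a"
      using y_le[of a b] by (simp add: piece_order_def leader m_eq cong: conj_cong)
    also have "\<dots> \<longleftrightarrow> b \<in> support (part a) \<and> block_index (part a) b \<le> block_index (part a) a"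
      using part_eq[of b a] by (auto simp: k_def)
    also have "\<dots> \<longleftrightarrow> (a, b) \<in> block_order (part a)"
      unfolding block_order_index[OF composite_member(1)[OF C part(1)]] using part(2)[of a] by simp
    also have "\<dots> \<longleftrightarrow> (a, b) \<in> composite_order C"
      using mem_composite_order_iff[OF C part(1)] part(2)[of a] by blast
    finally show ?thesis .
  qed
  then have "piece_order y = composite_order C"
    unfolding set_eq_iff split_paired_All by simp
  then show ?thesis by blast
qed

text \<open>The parts are the level sets of \<open>leader y\<close>, each listed by decreasing
  \<open>y\<close>. A leader lies in its own part, where it is the smallest index and has the
  largest value, which gives standardness.\<close>

lemma piece_order_ex_standard_composite_order:
  "\<exists>C. standard_composite_set_partition C \<and> composite_order C = piece_order y"
proof -
  define J where "J m = {a. leader y a = m}" for m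
  have "\<exists>S. ordered_set_partition_on (J m) S \<and>
      block_order S = {(a, b) \<in> J m \<times> J m. y $ a \<le> y $ b}" for m
    by (rule ex_ordered_set_partition) simp
  then obtain S where S: "\<And>m. ordered_set_partition_on (J m) (S m)"
    "\<And>m. block_order (S m) = {(a, b) \<in> J m \<times> J m. y $ a \<le> y $ b}" by metis
  have supp: "support (S m) = J m" for m
    using S(1) by (rule ordered_set_partition_on_support)
  \<comment> \<open>Labels outside the range of \<open>leader y\<close> have empty level
    sets.\<close>
  define C where "C = S ` range (leader y)"
  have lead_in: "m \<in> J m" if "m \<in> range (leader y)" for m
    using that by (auto simp: J_def leader_leader)
  have "composite_set_partition C"
    unfolding composite_set_partition_def
  proof (intro conjI)
    show "\<forall>S\<in>C. ordered_set_partition_on (support S) S"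
      using S(1) by (auto simp: C_def supp)
    have "m = m'" if "m \<in> range (leader y)" "J m = J m'" for m m'
    proof -
      have "m \<in> J m" "m \<in> J m'" using lead_in[OF that(1)] that(2) by auto
      then show ?thesis by (simp add: J_def)
    qed
    then show "inj_on support C"
      unfolding C_def by (intro inj_onI) (metis imageE supp)
    have "support ` C = J ` range (leader y)" by (auto simp: C_def image_image supp)
    moreover have "partition_on UNIV (J ` range (leader y))"
    proof (rule partition_onI)
      show "disjnt p q" if "p \<in> J ` range (leader y)" "q \<in> J ` range (leader y)" "p \<noteq> q" for p q
        using that by (auto simp: disjnt_def J_def)
      show "{} \<notin> J ` range (leader y)" using lead_in by blast
    qed (auto simp: J_def)
    ultimately show "partition_on UNIV (support ` C)" by simp
  qed
  moreover have "Min (support (S m)) \<in> hd (S m)" if m: "m \<in> range (leader y)" for m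
  proof -
    have "Min (support (S m)) = m"
      using lead_in[OF m] leader_self_le[of y] by (intro Min_eqI) (auto simp: supp J_def)
    moreover have "m \<in> hd (S m)"
      using block_order_hd[OF S(1), of m] lead_in[OF m] leader_ge[of y] by (auto simp: S(2) J_def)
    ultimately show ?thesis by simp
  qed
  ultimately have "standard_composite_set_partition C"
    by (auto simp: standard_composite_set_partition_def C_def)
  moreover have "composite_order C = piece_order y"
    by (auto simp: composite_order_def C_def S(2) J_def piece_order_def)
  ultimately show ?thesis by blast
qed

section \<open>Composite plates are dual to order cones\<close>

text \<open>Summation by parts along the blocks. Here \<open>s\<close> is the coordinate sum of the
  blocks already passed and \<open>\<zeta>\<close> bounds the remaining values of \<open>z\<close>;
  as \<open>s\<close> is nonnegative, lowering \<open>\<zeta>\<close> to the value of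
  \<open>z\<close> on the next block only decreases the expression.\<close>

lemma plate_pairing:
  fixes x z :: "real ^ 'n::finite"
  assumes "ordered_set_partition_on J S" "z \<in> order_cone (block_order S)"
    and "\<And>i. i \<le> length S \<Longrightarrow> 0 \<le> s + coord_sum x (support (take i S))"
    and "s + coord_sum x J = 0" "\<And>a. a \<in> J \<Longrightarrow> z $ a \<le> \<zeta>"
  shows "0 \<le> \<zeta> * s + (\<Sum>a\<in>J. x $ a * z $ a)"
  using assms
proof (induction S arbitrary: J s \<zeta>)
  case Nil
  then show ?case by (simp add: coord_sum_def)
next
  case (Cons T Ts)
  then have T: "T \<noteq> {}" "T \<subseteq> J" and Ts: "ordered_set_partition_on (J - T) Ts"
    by (auto simp: ordered_set_partition_on_Cons)
  note supp = ordered_set_partition_on_support[OF Ts]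
  obtain t where t: "t \<in> T" using T by blast
  have z: "z $ a \<le> z $ b" if "a \<in> J" "b \<in> T" for a b
    using Cons.prems(2) that T(2) by (auto simp: mem_order_cone supp)
  then have zT: "z $ a = z $ t" if "a \<in> T" for a
    using that t T by (meson antisym subsetD)
  have J: "sum f J = sum f T + sum f (J - T)" for f :: "'n \<Rightarrow> real"
    using T(2) by (simp add: sum.subset_diff add.commute)
  have "0 \<le> z $ t * (s + coord_sum x T) + (\<Sum>a\<in>J - T. x $ a * z $ a)"
  proof (rule Cons.IH[OF Ts])
    show "z \<in> order_cone (block_order Ts)"
      using Cons.prems(2) by (auto simp: mem_order_cone)
    show "0 \<le> s + coord_sum x T + coord_sum x (support (take i Ts))" if "i \<le> length Ts" for i
    proof -
      have "T \<inter> support (take i Ts) = {}"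
        using supp set_take_subset[of i Ts] by (fastforce simp: support_def)
      then show ?thesis
        using Cons.prems(3)[of "Suc i"] that by (simp add: coord_sum_def sum.union_disjoint)
    qed
    show "s + coord_sum x T + coord_sum x (J - T) = 0"
      using Cons.prems(4) J[of "\<lambda>a. x $ a"] by (simp add: coord_sum_def)
  qed (use z t in auto)
  moreover have "z $ t * s \<le> \<zeta> * s"
    using Cons.prems(3)[of 0] Cons.prems(5)[of t] t T
    by (intro mult_right_mono) (auto simp: coord_sum_def)
  moreover have "(\<Sum>a\<in>T. x $ a * z $ a) = z $ t * coord_sum x T"
    by (simp add: coord_sum_def sum_distrib_left zT mult.commute)
  ultimately show ?case
    using J[of "\<lambda>a. x $ a * z $ a"] by (simp add: algebra_simps)
qed

lemma plate_inner_nonneg: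
  assumes S: "ordered_set_partition_on J S" and z: "z \<in> order_cone (block_order S)"
    and x: "x \<in> plate S"
  shows "0 \<le> x \<bullet> z"
proof -
  note supp = ordered_set_partition_on_support[OF S]
  \<comment> \<open>A plate constrains only proper nonempty prefixes by inequalities; for the empty
    and the full prefix the sum is 0.\<close>
  have "0 \<le> coord_sum x (support (take i S))" if "i \<le> length S" for i
    using x that by (cases "i = 0 \<or> i = length S") (auto simp: plate_def coord_sum_def)
  then have "0 \<le> Max (range (($) z)) * 0 + (\<Sum>a\<in>J. x $ a * z $ a)"
    using x by (intro plate_pairing[OF S z]) (auto simp: plate_def supp)
  moreover have "x \<bullet> z = (\<Sum>a\<in>J. x $ a * z $ a)"
    unfolding inner_vec_def using x
    by (intro sum.mono_neutral_cong_right) (auto simp: plate_def supp)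
  ultimately show ?thesis by simp
qed

text \<open>One inclusion pairs each summand separately. For the other, \<open>x\<close> is tested
  against special vectors of the order cone and then split into its restrictions to the
  parts.\<close>

lemma composite_plate_eq_dual_cone:
  fixes C :: "'n::finite set list set"
  assumes C: "composite_set_partition C"
  shows "composite_plate C = dual_cone (order_cone (composite_order C))"
proof
  have alt: "composite_plate C = {sum s C |s. \<forall>S\<in>C. s S \<in> plate S}" if "finite C"
    using that by (simp add: composite_plate_def set_sum_alt)
  have "finite (support ` C)" by (rule finite_subset[OF subset_UNIV]) simp
  then have fin: "finite C"
    by (rule finite_imageD) (use C in \<open>simp add: composite_set_partition_def\<close>)
  show "composite_plate C \<subseteq> dual_cone (order_cone (composite_order C))"
  proof
    fix x assume "x \<in> composite_plate C"
    then obtain s where x: "x = sum s C" and s: "\<And>S. S \<in> C \<Longrightarrow> s S \<in> plate S"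
      by (auto simp: alt[OF fin])
    have "0 \<le> s S \<bullet> z" if "S \<in> C" "z \<in> order_cone (composite_order C)" for S z
      using that s by (intro plate_inner_nonneg[OF composite_member(1)[OF C that(1)]])
        (auto simp: mem_order_cone composite_order_def)
    then show "x \<in> dual_cone (order_cone (composite_order C))"
      by (auto simp: dual_cone_def x inner_sum_left intro!: sum_nonneg)
  qed
  show "dual_cone (order_cone (composite_order C)) \<subseteq> composite_plate C"
  proof
    fix x assume x: "x \<in> dual_cone (order_cone (composite_order C))"
    define s where "s S = (\<chi> j. if j \<in> support S then x $ j else 0)" for S
    \<comment> \<open>The test vector is the indicator of a prefix, an up-set.\<close>
    have prefix: "0 \<le> coord_sum x (support (take i S))" if S: "S \<in> C" for S i
    proof -
      define z :: "real ^ 'n" where "z = (\<chi> j. of_bool (j \<in> support (take i S)))"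
      have sub: "support (take i S) \<subseteq> support S"
        using set_take_subset[of i S] by (auto simp: support_def)
      have "z \<in> order_cone (composite_order C)"
        using mem_composite_order_iff[OF C S] sub block_order_take[OF composite_member(1)[OF C S]]
        by (fastforce simp: mem_order_cone z_def)
      then have "0 \<le> x \<bullet> z" using x by (auto simp: dual_cone_def)
      then show ?thesis
        by (simp add: inner_vec_def z_def coord_sum_def sum.If_cases of_bool_def if_distrib
            cong: if_cong)
    qed
    \<comment> \<open>A whole part is also closed downwards, so its negated indicator lies in the
      order cone. Together with \<open>prefix\<close> for the full list, the total is 0.\<close>
    have total: "coord_sum x (support S) \<le> 0" if S: "S \<in> C" for S
    proof -
      define z :: "real ^ 'n" where "z = (\<chi> j. - of_bool (j \<in> support S))"
      have "a \<in> support S" if "(a, b) \<in> composite_order C" "b \<in> support S" for a b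
        using that mem_composite_order_iff[OF C S, of a b]
          block_order_index[OF composite_member(1)[OF C S]] by auto
      then have "z \<in> order_cone (composite_order C)"
        by (auto simp: mem_order_cone z_def)
      then have "0 \<le> x \<bullet> z" using x by (auto simp: dual_cone_def)
      then show ?thesis
        by (simp add: inner_vec_def z_def coord_sum_def sum.If_cases of_bool_def if_distrib sum_negf
            cong: if_cong)
    qed
    have "s S \<in> plate S" if S: "S \<in> C" for S
    proof -
      have "coord_sum (s S) (support (take i S)) = coord_sum x (support (take i S))" for i
        unfolding coord_sum_def s_def using set_take_subset[of i S]
        by (intro sum.cong) (auto simp: support_def)
      then show ?thesis
        using prefix[OF S] prefix[OF S, of "length S"] total[OF S]
          \<open>coord_sum (s S) (support (take (length S) S)) = _\<close>
        by (auto simp: plate_def s_def)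
    qed
    moreover have "sum s C = x"
    proof (rule vec_eq_iff[THEN iffD2], rule allI)
      fix j
      obtain S where S: "S \<in> C" "j \<in> support S" using composite_cover[OF C] by blast
      have "(\<Sum>U\<in>C. s U $ j) = (\<Sum>U\<in>{S}. s U $ j)"
        using S fin composite_unique[OF C] by (intro sum.mono_neutral_right) (auto simp: s_def)
      then show "sum s C $ j = x $ j" using S by (simp add: s_def)
    qed
    ultimately show "x \<in> composite_plate C" by (auto simp: alt[OF fin])
  qed
qed

lemma plate_eq_dual_cone:
  fixes S :: "'n::finite set list"
  assumes "ordered_set_partition_on UNIV S"
  shows "plate S = dual_cone (order_cone (block_order S))"
proof -
  have "composite_set_partition {S}"
    using assms ordered_set_partition_on_support[OF assms]
    by (auto simp: composite_set_partition_def partition_on_def)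
  from composite_plate_eq_dual_cone[OF this] show ?thesis
    by (simp add: composite_plate_def composite_order_def)
qed

section \<open>The basis\<close>

definition dual_indicator :: "'n rel \<Rightarrow> real ^ 'n::finite \<Rightarrow> complex" where
  "dual_indicator E = indicator (dual_cone (order_cone E))"

lemma composite_plate_fun_image:
  "composite_plate_fun ` {C. standard_composite_set_partition C} =
    dual_indicator ` range (piece_order :: real ^ 'n::{finite,linorder} \<Rightarrow> _)"
proof -
  let ?I = "{C :: 'n::{finite,linorder} set list set. standard_composite_set_partition C}"
  have "composite_order ` ?I = range piece_order"
  proof (intro subset_antisym subsetI)
    fix E :: "'n::{finite,linorder} rel" assume "E \<in> composite_order ` ?I"
    then show "E \<in> range piece_order"
      using standard_composite_order_ex_piece_order by blast
  next
    fix E :: "'n::{finite,linorder} rel" assume "E \<in> range piece_order"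
    then obtain y where y: "E = piece_order y" by blast
    obtain C where "standard_composite_set_partition C" "composite_order C = piece_order y"
      using piece_order_ex_standard_composite_order by blast
    then show "E \<in> composite_order ` ?I" using y by blast
  qed
  moreover have "composite_plate_fun ` ?I = (\<lambda>C. dual_indicator (composite_order C)) ` ?I"
    by (rule image_cong) (simp_all add: composite_plate_fun_def dual_indicator_def
        composite_plate_eq_dual_cone standard_composite_set_partition_def)
  ultimately show ?thesis by (metis image_image)
qed

lemma plate_space_eq_span:
  "plate_space = cfun.span (dual_indicator ` range (weak_order :: real ^ 'n \<Rightarrow> _))"
proof -
  let ?O = "{S :: 'n::finite set list. ordered_set_partition_on UNIV S}"
  have "block_order ` ?O = range weak_order"
  proof (intro subset_antisym subsetI)
    fix E :: "'n rel" assume "E \<in> block_order ` ?O"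
    then obtain S where S: "ordered_set_partition_on UNIV S" "E = block_order S" by blast
    \<comment> \<open>The sign is negative because earlier blocks are higher.\<close>
    then have "E = weak_order (\<chi> a. - real (block_index S a))"
      using block_order_index[OF S(1)] by (simp add: weak_order_def)
    then show "E \<in> range weak_order" by blast
  next
    fix E :: "'n rel" assume "E \<in> range weak_order"
    then obtain y where y: "E = weak_order y" by blast
    obtain S where S: "ordered_set_partition_on UNIV S"
      "block_order S = {(a, b) \<in> UNIV \<times> UNIV. y $ a \<le> y $ b}"
      using ex_ordered_set_partition[OF finite_class.finite_UNIV, of "($) y"] by blast
    then have "E = block_order S" by (simp add: y weak_order_def)
    then show "E \<in> block_order ` ?O" using S(1) by blast
  qed
  then have "dual_indicator ` range weak_order = (\<lambda>S. dual_indicator (block_order S)) ` ?O"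
    by (metis image_image)
  also have "\<dots> = (\<lambda>S. indicator (plate S)) ` ?O"
    by (rule image_cong) (simp_all add: dual_indicator_def plate_eq_dual_cone)
  finally show ?thesis by (simp add: plate_space_def setcompr_eq_image)
qed

text \<open>The left side is moved into the sum, giving a relation with coefficients
  \<open>d\<close> over all relations, which also covers \<open>E0\<close> in \<open>F\<close>; then
  the transfer applies.\<close>

lemma dual_indicator_expansion:
  assumes "\<And>z. indicator (order_cone E0) z = (\<Sum>E\<in>F. c E * indicator (order_cone E) z)"
  shows "dual_indicator E0 x = (\<Sum>E\<in>F. c E * dual_indicator E x)"
proof -
  define d where "d E = (if E \<in> F then c E else 0) - of_bool (E = E0)" for E
  have d: "(\<Sum>E\<in>UNIV. d E * f E) = (\<Sum>E\<in>F. c E * f E) - f E0" for f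
  proof -
    have "d E * f E = (if E \<in> F then c E * f E else 0) - (if E = E0 then f E else 0)" for E
      by (simp add: d_def left_diff_distrib)
    then show ?thesis by (simp add: sum_subtractf sum.If_cases)
  qed
  show ?thesis
    using order_cone_relation_iff[of d UNIV] assms unfolding d dual_indicator_def by simp
qed

lemma sum_fun_apply: "(\<Sum>i\<in>A. f i) x = (\<Sum>i\<in>A. f i x)"
  by (induction A rule: infinite_finite_induct) auto

text \<open>Every order cone is a union of weak-order cells, so its indicator is constant on the
  fibres of \<open>K\<close> and expands in the triangular family. The expansion is then
  dualized.\<close>

lemma dual_indicator_in_span:
  assumes "triangular_family (range K) order_cone K \<mu>"
    and "\<And>z z'. K z = K z' \<Longrightarrow> weak_order z = weak_order z'"
  shows "dual_indicator E \<in> cfun.span (dual_indicator ` range K)"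
proof -
  interpret triangular_family "range K" order_cone K \<mu> by (fact assms(1))
  have "\<exists>c. \<forall>z. indicator (order_cone E) z = (\<Sum>E\<in>range K. c E * indicator (order_cone E) z :: complex)"
  proof (rule spanning)
    show "indicator (order_cone E) z = (indicator (order_cone E) z' :: complex)"
      if "K z = K z'" for z z'
      using assms(2)[OF that] by (simp add: indicator_def order_cone_iff_weak_order)
  qed
  then obtain c where "\<And>z. indicator (order_cone E) z =
      (\<Sum>E\<in>range K. c E * indicator (order_cone E) z :: complex)" by blast
  then have "dual_indicator E x = (\<Sum>E\<in>range K. c E * dual_indicator E x)" for x
    by (rule dual_indicator_expansion)
  then have "dual_indicator E = (\<Sum>E\<in>range K. cfun_scale (c E) (dual_indicator E))"
    by (simp add: fun_eq_iff sum_fun_apply cfun_scale_def)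
  also have "\<dots> \<in> cfun.span (dual_indicator ` range K)"
    by (intro cfun.span_sum cfun.span_scale cfun.span_base) auto
  finally show ?thesis .
qed

text \<open>Equal dual cones give equal order cones. Points with piece orders \<open>E\<close> and
  \<open>E'\<close> would then lie in both cones, so if \<open>E\<close> and \<open>E'\<close>
  differed, each would have smaller measure than the other.\<close>

lemma inj_on_dual_indicator_piece_order: "inj_on dual_indicator (range piece_order)"
proof (rule inj_onI)
  fix E E' :: "'n::{finite,linorder} rel"
  assume E: "E \<in> range piece_order" "E' \<in> range piece_order"
    and eq: "dual_indicator E = dual_indicator E'"
  have "x \<in> dual_cone (order_cone E) \<longleftrightarrow> x \<in> dual_cone (order_cone E')" for x
    using fun_cong[OF eq, of x] by (simp add: dual_indicator_def indicator_def of_bool_eq_iff)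
  then have "dual_cone (order_cone E) = dual_cone (order_cone E')" by blast
  then have "order_cone E = order_cone E'" by (metis dual_dual_order_cone)
  then show "E = E'"
    using E piece.self piece.less by (metis imageE less_asym)
qed

lemma independent_dual_indicator_piece_order:
  "cfun.independent (dual_indicator ` range (piece_order :: real ^ 'n::{finite,linorder} \<Rightarrow> _))"
proof (rule cfun.independent_if_scalars_zero)
  fix u :: "(real ^ 'n::{finite,linorder} \<Rightarrow> complex) \<Rightarrow> complex"
    and f :: "real ^ 'n::{finite,linorder} \<Rightarrow> complex"
  assume zero: "(\<Sum>f\<in>dual_indicator ` range piece_order. cfun_scale (u f) f) = 0"
    and f: "f \<in> dual_indicator ` range piece_order"
  have "(\<Sum>E\<in>range piece_order. cfun_scale (u (dual_indicator E)) (dual_indicator E)) = 0"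
    using zero by (simp add: sum.reindex[OF inj_on_dual_indicator_piece_order])
  then have "(\<Sum>E\<in>range piece_order. u (dual_indicator E) * dual_indicator E x) = 0" for x
    by (simp add: fun_eq_iff sum_fun_apply cfun_scale_def)
  then have "(\<Sum>E\<in>range piece_order. u (dual_indicator E) * indicator (order_cone E) z) = 0" for z
    using order_cone_relation_iff[of "\<lambda>E. u (dual_indicator E)" "range piece_order"]
    by (simp add: dual_indicator_def)
  then show "u f = 0"
    using piece.independent[of "\<lambda>E. u (dual_indicator E)"] f by blast
qed simp

theorem theorem4p6:
  fixes I :: "('n::{finite,linorder}) set list set set"
  assumes "I = {C. standard_composite_set_partition C}"
  shows "inj_on composite_plate_fun I
       \<and> cfun.independent (composite_plate_fun ` I)
       \<and> cfun.span (composite_plate_fun ` I) = plate_space"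
proof (intro conjI)
  have image: "composite_plate_fun ` I = dual_indicator ` range piece_order"
    using composite_plate_fun_image assms by simp
  show "cfun.independent (composite_plate_fun ` I)"
    unfolding image by (rule independent_dual_indicator_piece_order)
  show "cfun.span (composite_plate_fun ` I) = plate_space"
    \<comment> \<open>Each generating family lies in the span of the other, by the same lemma for
      piece orders and for weak orders.\<close>
    unfolding image plate_space_eq_span cfun.span_eq
    using dual_indicator_in_span[OF piece.triangular_family_axioms]
      dual_indicator_in_span[OF weak.triangular_family_axioms]
    by (auto simp: piece_order_eq_iff)
  show "inj_on composite_plate_fun I"
  proof (rule inj_onI)
    fix C C' assume C: "C \<in> I" "C' \<in> I" and eq: "composite_plate_fun C = composite_plate_fun C'"
    have comp: "composite_set_partition C" "composite_set_partition C'"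
      using C assms by (auto simp: standard_composite_set_partition_def)
    have "dual_indicator (composite_order C) = dual_indicator (composite_order C')"
      using eq by (simp add: composite_plate_fun_def dual_indicator_def
          composite_plate_eq_dual_cone comp)
    moreover have "composite_order C \<in> range piece_order" "composite_order C' \<in> range piece_order"
      using C assms standard_composite_order_ex_piece_order by (metis mem_Collect_eq rangeI)+
    ultimately have "composite_order C = composite_order C'"
      using inj_on_dual_indicator_piece_order by (meson inj_onD)
    then show "C = C'" using comp by (intro composite_order_inject)
  qed
qed

end
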